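(* Let $A\in\mathbb{R}^{n\times d}$ be a matrix of rank $t$ with $\|A\|_2\le1$. Let $\lambda_i$ be the $i$-th largest eigenvalue of $A^TA$. Let $k$ be an integer with $2\le k\le t-1$, and assume $\lambda_1>\lambda_k$. Then $$\mathrm{maxroot}\ \mathcal{R}_{x,d}^+\cdot(\partial_x\cdot x\cdot\partial_x)^k\cdot\mathcal{R}_{x,d}^+\ \det[xI_d-A^TA]\ \le\ \frac{(t-k+1)\,t}{(1-\sqrt{\alpha_k})^2}\cdot\lambda_{k+1},$$ where $$\alpha_k=\frac{\frac1{\lambda_{k+1}}-\frac1k\sum_{i=1}^k\frac1{\lambda_i}}{\frac1{\lambda_{k+1}}-1}\in(0,1).$$
   Context: $\|\cdot\|_2$ is the spectral norm. $\mathrm{maxroot}\,f$ is the largest root of a real-rooted polynomial $f$. $\partial_x$ is the derivative operator. For a polynomial $p$ of degree at most $d$, $\mathcal{R}_{x,d}^+\,p(x):=x^dp(1/x)$. The operator $\partial_x\cdot x\cdot\partial_x$ sends $f$ to $\partial_x(x\,\partial_xf)$; a dot product of operators is composition, applied from right to left. *)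

theory Defs
  imports "HOL-Analysis.Analysis" "HOL-Computational_Algebra.Computational_Algebra"
begin

definition spectral_norm :: "real ^ 'd ^ 'n \<Rightarrow> real" where
  "spectral_norm A = onorm (\<lambda>x. A *v x)"

definition charpoly :: "real ^ 'd ^ 'd \<Rightarrow> real poly" where
  "charpoly M = det (\<chi> i j. (if i = j then [:0, 1:] else 0) - [:M $ i $ j:])"

text \<open>
  The real eigenvalues of \<open>M\<close>, repeated according to algebraic multiplicity, in decreasing
  order. \<open>eigval M i\<close> is the \<open>i\<close>-th largest one, counted from \<open>i = 1\<close>. For a
  symmetric \<open>d \<times> d\<close> matrix the list has length \<open>d\<close>, so \<open>eigval M i\<close> is
  meaningful for \<open>1 \<le> i \<le> d\<close>.
\<close>

definition eigvals :: "real ^ 'd ^ 'd \<Rightarrow> real list" where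
  "eigvals M = rev (sorted_list_of_multiset (proots (charpoly M)))"

definition eigval :: "real ^ 'd ^ 'd \<Rightarrow> nat \<Rightarrow> real" where
  "eigval M i = eigvals M ! (i - 1)"

text \<open>
  The polynomial \<open>x\<^sup>d p(1/x)\<close>, for \<open>degree p \<le> d\<close>. It differs from
  \<^const>\<open>reflect_poly\<close>, which uses \<open>degree p\<close> in place of \<open>d\<close>.
\<close>

definition reverse_poly :: "nat \<Rightarrow> real poly \<Rightarrow> real poly" where
  "reverse_poly d p = (\<Sum>i\<le>d. monom (coeff p i) (d - i))"

lemma poly_reverse_poly:
  assumes "degree p \<le> d" "x \<noteq> 0"
  shows "poly (reverse_poly d p) x = x ^ d * poly p (1 / x)"
proof -
  have "poly p (1 / x) = (\<Sum>i\<le>d. coeff p i * (1 / x) ^ i)"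
    unfolding poly_altdef using assms(1)
    by (intro sum.mono_neutral_left) (auto simp: coeff_eq_0)
  moreover have "x ^ (d - i) = x ^ d * (1 / x) ^ i" if "i \<le> d" for i
    using that assms(2) by (simp add: power_diff power_one_over divide_simps)
  ultimately show ?thesis
    by (simp add: reverse_poly_def poly_sum poly_monom sum_distrib_left mult_ac)
qed

definition dxd :: "real poly \<Rightarrow> real poly" where
  "dxd f = pderiv ([:0, 1:] * pderiv f)"

definition real_rooted :: "real poly \<Rightarrow> bool" where
  "real_rooted f \<longleftrightarrow> f \<noteq> 0 \<and> (\<forall>z. poly (map_poly complex_of_real f) z = 0 \<longrightarrow> z \<in> \<real>)"

text \<open>Meaningful for real-rooted polynomials of positive degree.\<close>

definition maxroot :: "real poly \<Rightarrow> real" where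
  "maxroot f = Max {x. poly f x = 0}"

definition transformed_charpoly :: "nat \<Rightarrow> real ^ 'd ^ 'n \<Rightarrow> real poly" where
  "transformed_charpoly k A =
     reverse_poly CARD('d) ((dxd ^^ k) (reverse_poly CARD('d) (charpoly (transpose A ** A))))"

definition alpha :: "(nat \<Rightarrow> real) \<Rightarrow> nat \<Rightarrow> real" where
  "alpha lam k =
     (1 / lam (k + 1) - (1 / real k) * (\<Sum>i = 1..k. 1 / lam i)) / (1 / lam (k + 1) - 1)"

end

theory Submission
  imports Defs
begin

text \<open>
  The largest root of the reversed polynomial is controlled by two coefficients only.

  Let \<open>q(x) = \<Prod>(1 - \<lambda>\<^sub>i x)\<close> be the reversed characteristic polynomial of \<open>A\<^sup>T A\<close> and \<open>Q\<close> its image under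
  the \<open>k\<close>-th power of \<open>\<partial> x \<partial>\<close>. For nonconstant polynomials the operator preserves the property, by Gauss-Lucas, that all
  roots are real and positive (\<open>positive_rooted_dxd\<close>). This makes the transformed polynomial
  real-rooted: its nonzero roots are the numbers \<open>1/s\<close>, where \<open>s\<close> runs over the roots of \<open>Q\<close>. All of these are
  positive, so each is at most their sum \<open>- Q\<^sub>1/Q\<^sub>0\<close>, where \<open>Q\<^sub>0\<close> and \<open>Q\<^sub>1\<close> are the two lowest
  coefficients (\<open>inverse_root_le_coeff_ratio\<close>).

  In terms of the elementary symmetric functions of the eigenvalues this sum is
  \<open>(k + 1)\<^sup>2 e (k + 1) / e k\<close>. A double count of pairs of a set and a deleted element gives
  \<open>e (k + 1) (\<Sum>1/\<lambda>\<^sub>i) \<le> (t - k) e k\<close>, where the sum runs over the first \<open>k + 1\<close> eigenvalues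
  (\<open>elem_sym_Suc_bound\<close>). By the definition of \<open>\<alpha>\<close> that sum is at least
  \<open>(k + 1) (1 - \<alpha>) / \<lambda>\<close> with \<open>\<lambda>\<close> the eigenvalue number \<open>k + 1\<close> (\<open>alpha_bounds\<close>). The largest root is therefore at most
  \<open>(k + 1) (t - k) \<lambda> / (1 - \<alpha>)\<close>, and the claim follows from \<open>k + 1 \<le> t\<close> and
  \<open>(1 - sqrt \<alpha>)\<^sup>2 \<le> 1 - \<alpha>\<close>.

  What the matrix contributes is contained in \<open>gram_eigvals\<close>: the eigenvalues of \<open>A\<^sup>T A\<close> lie between
  0 and the squared spectral norm, hence in \<open>[0, 1]\<close>, and exactly \<open>t\<close> of them are positive. This rests on the spectral theorem for symmetric
  matrices.
\<close>

section \<open>The spectral theorem for real symmetric matrices\<close>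

text \<open>
  The Rayleigh quotient \<open>x \<bullet> f x\<close> attains a maximum \<open>c\<close> on the compact unit sphere of \<open>S\<close>. The
  form \<open>x \<bullet> (c x - f x)\<close> is then nonnegative on \<open>S\<close> and vanishes at the maximiser \<open>v\<close>; a zero of a
  nonnegative quadratic form lies in the kernel of the form, so \<open>f v = c v\<close>.
\<close>

lemma selfadjoint_eigenvector_in_invariant_subspace:
  fixes f :: "'a::euclidean_space \<Rightarrow> 'a"
  assumes lin: "linear f" and adj: "\<And>x y. f x \<bullet> y = x \<bullet> f y"
    and S: "subspace S" and inv: "\<And>x. x \<in> S \<Longrightarrow> f x \<in> S"
    and u: "u \<in> S" "u \<noteq> 0"
  obtains v c where "v \<in> S" "norm v = 1" "f v = c *\<^sub>R v"
proof -
  have "compact (S \<inter> sphere 0 1)"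
    using S by (intro closed_Int_compact closed_subspace) auto
  moreover have "u /\<^sub>R norm u \<in> S \<inter> sphere 0 1"
    using S u by (auto simp: subspace_mul)
  moreover have "continuous_on (S \<inter> sphere 0 1) (\<lambda>x. x \<bullet> f x)"
    using lin by (intro continuous_intros linear_continuous_on)
      (auto simp: linear_conv_bounded_linear)
  ultimately obtain v where v: "v \<in> S \<inter> sphere 0 1"
    and max: "\<And>w. w \<in> S \<inter> sphere 0 1 \<Longrightarrow> w \<bullet> f w \<le> v \<bullet> f v"
    using continuous_attains_sup[of "S \<inter> sphere 0 1" "\<lambda>x. x \<bullet> f x"] by blast
  define c where "c = v \<bullet> f v"
  define g where "g = (\<lambda>x. c *\<^sub>R x - f x)"
  have lg: "linear g"
    unfolding g_def using lin by (intro linear_compose_sub linear_scale_self)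
  have adjg: "g x \<bullet> y = x \<bullet> g y" for x y
    by (simp add: g_def inner_diff adj)
  have gS: "g x \<in> S" if "x \<in> S" for x
    using that S inv by (simp add: g_def subspace_mul subspace_diff)
  have psd: "0 \<le> x \<bullet> g x" if "x \<in> S" for x
  proof (cases "x = 0")
    case False
    have "(x /\<^sub>R norm x) \<bullet> f (x /\<^sub>R norm x) \<le> c"
      unfolding c_def using False that S by (intro max) (auto simp: subspace_mul)
    hence "x \<bullet> f x \<le> c * (norm x)\<^sup>2"
      using False lin by (simp add: linear_scale field_simps power2_eq_square)
    thus ?thesis by (simp add: g_def inner_diff_right power2_norm_eq_inner)
  qed auto
  have gv: "v \<bullet> g v = 0"
    using v by (simp add: g_def inner_diff_right c_def flip: power2_norm_eq_inner)
  \<comment> \<open>Along the line \<open>v - s *\<^sub>R g v\<close> the nonnegative form would be negative for small \<open>s > 0\<close>.\<close>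
  have "g v = 0"
  proof (rule ccontr)
    assume nz: "g v \<noteq> 0"
    define a where "a = g v \<bullet> g v"
    define b where "b = g v \<bullet> g (g v)"
    have a: "a > 0" using nz by (simp add: a_def)
    have b: "b \<ge> 0" using v gS psd by (simp add: b_def)
    define s where "s = a / (b + 1)"
    have s: "s > 0" using a b by (simp add: s_def)
    have "v - s *\<^sub>R g v \<in> S"
      using v S gS by (simp add: subspace_mul subspace_diff)
    hence "0 \<le> (v - s *\<^sub>R g v) \<bullet> g (v - s *\<^sub>R g v)"
      by (rule psd)
    also have "\<dots> = v \<bullet> g v - s * (v \<bullet> g (g v)) - s * a + s * (s * b)"
      using lg by (simp add: linear_diff linear_scale inner_diff a_def b_def algebra_simps)
    also have "v \<bullet> g (g v) = a"
      unfolding a_def by (rule adjg[symmetric])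
    also have "v \<bullet> g v - s * a - s * a + s * (s * b) = s * (s * b - 2 * a)"
      by (simp add: gv algebra_simps)
    finally have "2 * a \<le> s * b"
      using s by (simp add: zero_le_mult_iff)
    moreover have "s * b \<le> a"
      using a b by (simp add: s_def field_simps)
    ultimately show False using a by simp
  qed
  hence "f v = c *\<^sub>R v" by (simp add: g_def)
  with v show ?thesis by (intro that[of v c]) auto
qed

text \<open>
  The orthogonal complement of a set of eigenvectors is invariant under a self-adjoint map, so the
  preceding lemma supplies a further eigenvector as long as that complement is nonzero.
\<close>

lemma selfadjoint_orthonormal_eigenvectors:
  fixes f :: "'a::euclidean_space \<Rightarrow> 'a"
  assumes lin: "linear f" and adj: "\<And>x y. f x \<bullet> y = x \<bullet> f y"
    and "m \<le> DIM('a)"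
  shows "\<exists>B. finite B \<and> card B = m \<and> pairwise orthogonal B \<and>
    (\<forall>b\<in>B. norm b = 1 \<and> (\<exists>c. f b = c *\<^sub>R b))"
  using assms(3)
proof (induction m)
  case 0
  show ?case by (intro exI[of _ "{}"]) auto
next
  case (Suc m)
  then obtain B where B: "finite B" "card B = m" "pairwise orthogonal B"
    and eig: "\<And>b. b \<in> B \<Longrightarrow> norm b = 1 \<and> (\<exists>c. f b = c *\<^sub>R b)" by auto
  define S where "S = {y. \<forall>x\<in>B. orthogonal x y}"
  have "subspace S" unfolding S_def by (rule subspace_orthogonal_to_vectors)
  moreover have "f y \<in> S" if "y \<in> S" for y
    unfolding S_def
  proof safe
    fix b assume b: "b \<in> B"
    with eig obtain c where "f b = c *\<^sub>R b" by blast
    with that b adj[of b y] show "orthogonal b (f y)"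
      by (auto simp: S_def orthogonal_def)
  qed
  \<comment> \<open>With fewer vectors than dimensions the complement contains a nonzero \<open>u\<close>.\<close>
  moreover have "dim B < DIM('a)"
    using dim_le_card'[OF B(1)] B(2) Suc.prems by simp
  then obtain u where "u \<noteq> 0" "\<And>y. y \<in> span B \<Longrightarrow> orthogonal u y"
    using orthogonal_to_subspace_exists by blast
  hence "u \<in> S" "u \<noteq> 0"
    by (auto simp: S_def span_base orthogonal_commute)
  ultimately obtain v c where v: "v \<in> S" "norm v = 1" "f v = c *\<^sub>R v"
    using selfadjoint_eigenvector_in_invariant_subspace[OF lin adj] by metis
  have "v \<notin> B"
  proof
    assume "v \<in> B"
    with v(1) have "orthogonal v v" by (auto simp: S_def)
    with v(2) show False by (auto simp: orthogonal_self)
  qed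
  show ?case
  proof (intro exI[of _ "insert v B"] conjI ballI)
    show "pairwise orthogonal (insert v B)"
      using B(3) v(1) by (auto simp: pairwise_insert S_def orthogonal_commute)
  qed (use B eig v \<open>v \<notin> B\<close> in auto)
qed

lemma symmetric_matrix_orthonormal_eigenbasis:
  fixes M :: "real ^ 'd ^ 'd"
  assumes "transpose M = M"
  obtains v :: "'d \<Rightarrow> real ^ 'd" and \<mu> :: "'d \<Rightarrow> real"
  where "\<And>i j. v i \<bullet> v j = (if i = j then 1 else 0)" "\<And>i. M *v v i = \<mu> i *\<^sub>R v i"
proof -
  have adj: "(M *v x) \<bullet> y = x \<bullet> (M *v y)" for x y
    using dot_lmul_matrix[of x "M" y] assms by (metis vector_transpose_matrix)
  have "\<exists>B. finite B \<and> card B = CARD('d) \<and> pairwise orthogonal B \<and>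
    (\<forall>b\<in>B. norm b = 1 \<and> (\<exists>c. M *v b = c *\<^sub>R b))"
    by (rule selfadjoint_orthonormal_eigenvectors) (auto simp: adj)
  then obtain B where B: "finite B" "card B = CARD('d)" "pairwise orthogonal B"
    "\<And>b. b \<in> B \<Longrightarrow> norm b = 1" "\<forall>b\<in>B. \<exists>c. M *v b = c *\<^sub>R b" by auto
  from B(5) obtain c where c: "\<And>b. b \<in> B \<Longrightarrow> M *v b = c b *\<^sub>R b" by metis
  obtain v where v: "bij_betw v (UNIV :: 'd set) B"
    using finite_same_card_bij[of "UNIV :: 'd set" B] B by auto
  have vB: "v i \<in> B" for i using v by (auto simp: bij_betw_def)
  have "v i \<bullet> v j = (if i = j then 1 else 0)" for i j
  proof (cases "i = j")
    case True
    with B(4)[OF vB[of i]] show ?thesis by (simp flip: power2_norm_eq_inner)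
  next
    case False
    hence "v i \<noteq> v j" using v by (auto simp: bij_betw_def inj_on_def)
    with B(3) vB have "orthogonal (v i) (v j)" by (auto simp: pairwise_def)
    with False show ?thesis by (simp add: orthogonal_def)
  qed
  moreover have "M *v v i = c (v i) *\<^sub>R v i" for i using c vB by simp
  ultimately show ?thesis using that[of v "\<lambda>i. c (v i)"] by simp
qed

section \<open>Characteristic polynomials and the spectrum of a Gram matrix\<close>

lemma poly_charpoly: "poly (charpoly M) x = det (mat x - M)"
  unfolding charpoly_def det_def
  by (simp add: poly_sum poly_prod mat_def if_distrib[of "\<lambda>p. poly p x"] cong: if_cong)

text \<open>
  Conjugating \<open>x I - M\<close> by the orthogonal matrix with rows \<open>v i\<close> makes it diagonal. The conjugation is
  done at every real number \<open>x\<close>, which avoids matrices over the polynomial ring; a real polynomial is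
  determined by its values.
\<close>

lemma charpoly_of_orthonormal_eigenbasis:
  fixes M :: "real ^ 'd ^ 'd" and v :: "'d \<Rightarrow> real ^ 'd" and \<mu> :: "'d \<Rightarrow> real"
  assumes orth: "\<And>i j. v i \<bullet> v j = (if i = j then 1 else 0)"
    and eig: "\<And>i. M *v v i = \<mu> i *\<^sub>R v i"
  shows "charpoly M = (\<Prod>i\<in>UNIV. [:- \<mu> i, 1:])"
proof -
  define V :: "real ^ 'd ^ 'd" where "V = (\<chi> i. v i)"
  have conj: "(V ** (N ** transpose V)) $ i $ j = v i \<bullet> (N *v v j)" for N i j
    by (simp add: V_def matrix_matrix_mult_def transpose_def matrix_vector_mult_def inner_vec_def)
  have "V ** transpose V = mat 1"
    using conj[of "mat 1", unfolded matrix_mul_lid matrix_vector_mul_lid orth]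
    by (simp add: vec_eq_iff mat_def)
  hence det1: "det V * det (transpose V) = 1"
    by (simp only: det_I flip: det_mul)
  have "poly (charpoly M) x = poly (\<Prod>i\<in>UNIV. [:- \<mu> i, 1:]) x" for x
  proof -
    have scal: "mat x *v w = x *\<^sub>R w" for w :: "real ^ 'd"
      by (simp add: vec_eq_iff matrix_vector_mult_def mat_def if_distrib if_distribR cong: if_cong)
    have entry: "(V ** ((mat x - M) ** transpose V)) $ i $ j = (if i = j then x - \<mu> i else 0)" for i j
      unfolding conj by (simp add: matrix_vector_mult_diff_rdistrib scal eig inner_diff_right orth)
    have "det (mat x - M) = det (V ** ((mat x - M) ** transpose V))"
      unfolding det_mul using det1 by (metis mult.commute mult.left_commute mult_1)
    also have "\<dots> = (\<Prod>i\<in>UNIV. x - \<mu> i)"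
      by (subst det_diagonal) (auto simp: entry)
    finally show ?thesis by (simp add: poly_charpoly poly_prod)
  qed
  thus ?thesis by (intro poly_eq_poly_eq_iff[THEN iffD1] ext)
qed

lemma downward_closed_eq_lessThan:
  fixes S :: "nat set"
  assumes "finite S" and "\<And>i j. i \<le> j \<Longrightarrow> j \<in> S \<Longrightarrow> i \<in> S"
  shows "S = {..<card S}"
proof (intro card_subset_eq subsetI)
  fix j assume "j \<in> S"
  with assms(2) have "{..j} \<subseteq> S" by auto
  from card_mono[OF assms(1) this] show "j \<in> {..<card S}" by simp
qed auto

text \<open>
  The vectors \<open>A v\<^sub>i\<close> span the range of \<open>A\<close>. They are pairwise orthogonal with squared lengths \<open>\<mu> i\<close>, because
  their Gram matrix is that of \<open>A\<^sup>T A\<close> in the eigenbasis. So the nonzero ones form a basis of the range.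
\<close>

lemma rank_eq_card_nonzero_gram_eigenvalues:
  fixes A :: "real ^ 'd ^ 'n" and v :: "'d \<Rightarrow> real ^ 'd"
  assumes orth: "\<And>i j. v i \<bullet> v j = (if i = j then 1 else 0)"
    and eig: "\<And>i. transpose A ** A *v v i = \<mu> i *\<^sub>R v i"
  shows "rank A = card {i. \<mu> i \<noteq> 0}"
    and "\<mu> i = (norm (A *v v i))\<^sup>2"
proof -
  have gram: "(A *v v i) \<bullet> (A *v v j) = (if i = j then \<mu> j else 0)" for i j
  proof -
    have "(A *v v i) \<bullet> (A *v v j) = (transpose A *v (A *v v j)) \<bullet> v i"
      by (metis dot_lmul_matrix inner_commute transpose_matrix_vector)
    thus ?thesis by (simp add: matrix_vector_mul_assoc eig orth)
  qed
  show norm: "\<mu> i = (norm (A *v v i))\<^sup>2" for i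
    using gram[of i i] by (simp add: power2_norm_eq_inner)
  have v0: "v i \<noteq> 0" for i using orth[of i i] by auto
  have "inj v"
    by (intro injI) (metis orth zero_neq_one)
  have "independent (range v)"
    using v0 orth by (intro pairwise_orthogonal_independent)
      (auto simp: pairwise_def orthogonal_def)
  hence "dim (range v) = DIM(real ^ 'd)"
    using \<open>inj v\<close> by (simp add: dim_eq_card_independent card_image)
  hence span_v: "span (range v) = UNIV" by (simp only: dim_eq_full)
  define J where "J = {i. \<mu> i \<noteq> 0}"
  define W where "W = (\<lambda>i. A *v v i) ` J"
  have inj: "inj_on (\<lambda>i. A *v v i) J"
  proof (intro inj_onI)
    fix i j assume "i \<in> J" "j \<in> J" "A *v v i = A *v v j"
    with gram[of i j] gram[of j j] show "i = j" by (auto simp: J_def split: if_splits)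
  qed
  have "0 \<notin> W"
    using norm by (auto simp: W_def J_def)
  hence indep: "independent W"
    using gram by (intro pairwise_orthogonal_independent)
      (auto simp: W_def pairwise_def orthogonal_def split: if_splits)
  have "range (\<lambda>x. A *v x) = span ((\<lambda>x. A *v x) ` range v)"
    using span_v by (simp add: linear_span_image)
  \<comment> \<open>Eigenvectors with eigenvalue 0 are sent to 0, so dropping them does not change the span.\<close>
  also have "(\<lambda>x. A *v x) ` range v \<subseteq> insert 0 W"
    using norm by (auto simp: W_def J_def)
  hence "span ((\<lambda>x. A *v x) ` range v) = span W"
  proof (intro antisym)
    assume "(\<lambda>x. A *v x) ` range v \<subseteq> insert 0 W"
    from span_mono[OF this] show "span ((\<lambda>x. A *v x) ` range v) \<subseteq> span W"
      by (simp add: span_insert_0)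
    show "span W \<subseteq> span ((\<lambda>x. A *v x) ` range v)"
      by (intro span_mono) (auto simp: W_def)
  qed
  finally have "rank A = card W"
    using indep by (simp add: rank_dim_range dim_eq_card_independent)
  thus "rank A = card {i. \<mu> i \<noteq> 0}"
    using inj by (simp add: W_def card_image J_def)
qed

text \<open>
  The spectrum of a Gram matrix in terms of the decreasing list of eigenvalues (indexed from 0): all
  \<open>CARD('d)\<close> roots of the characteristic polynomial are real, and since they are nonnegative and sorted,
  the \<open>rank A\<close> nonzero ones occupy exactly the first \<open>rank A\<close> positions.
\<close>

lemma gram_eigvals:
  fixes A :: "real ^ 'd ^ 'n"
  defines "L \<equiv> eigvals (transpose A ** A)"
  shows "length L = CARD('d)"
    and "rank A \<le> CARD('d)"
    and "charpoly (transpose A ** A) = (\<Prod>i<CARD('d). [:- (L ! i), 1:])"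
    and "i \<le> j \<Longrightarrow> j < CARD('d) \<Longrightarrow> L ! j \<le> L ! i"
    and "i < CARD('d) \<Longrightarrow> L ! i \<le> (spectral_norm A)\<^sup>2"
    and "i < rank A \<Longrightarrow> 0 < L ! i"
    and "rank A \<le> i \<Longrightarrow> i < CARD('d) \<Longrightarrow> L ! i = 0"
proof -
  have "transpose (transpose A ** A) = transpose A ** A"
    by (simp add: matrix_transpose_mul)
  then obtain v and \<mu> :: "'d \<Rightarrow> real"
    where orth: "\<And>i j. v i \<bullet> v j = (if i = j then 1 else 0)"
    and eig: "\<And>i. transpose A ** A *v v i = \<mu> i *\<^sub>R v i"
    using symmetric_matrix_orthonormal_eigenbasis by blast
  note rank = rank_eq_card_nonzero_gram_eigenvalues(1)[OF orth eig]
  note mu = rank_eq_card_nonzero_gram_eigenvalues(2)[OF orth eig]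
  have cp: "charpoly (transpose A ** A) = (\<Prod>i\<in>UNIV. [:- \<mu> i, 1:])"
    by (rule charpoly_of_orthonormal_eigenbasis[OF orth eig])
  have msum: "(\<Sum>i\<in>I. {#\<mu> i#}) = image_mset \<mu> (mset_set I)" if "finite I" for I
    using that by (induction I) auto
  have ms: "mset L = image_mset \<mu> (mset_set UNIV)"
    by (simp add: L_def eigvals_def cp proots_prod msum)
  from arg_cong[OF this, of size] show len: "length L = CARD('d)" by simp
  show "rank A \<le> CARD('d)" unfolding rank by (intro card_mono) auto
  have "charpoly (transpose A ** A) = prod_mset (image_mset (\<lambda>r. [:- r, 1:]) (mset L))"
    by (simp add: cp ms multiset.map_comp o_def prod_unfold_prod_mset)
  also have "\<dots> = (\<Prod>i<CARD('d). [:- (L ! i), 1:])"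
    unfolding mset_map[symmetric] prod_mset_prod_list prod.list_conv_set_nth
    by (simp add: len atLeast0LessThan)
  finally show "charpoly (transpose A ** A) = (\<Prod>i<CARD('d). [:- (L ! i), 1:])" .
  have sorted: "sorted_wrt (\<ge>) L"
    by (simp add: L_def eigvals_def sorted_wrt_rev)
  show anti: "L ! j \<le> L ! i" if "i \<le> j" "j < CARD('d)" for i j
    using that sorted_wrt_nth_less[OF sorted, of i j] by (cases "i = j") (auto simp: len)
  have mem: "\<exists>j. L ! i = \<mu> j" if "i < CARD('d)" for i
  proof -
    have "L ! i \<in># mset L" using that by (simp add: len)
    thus ?thesis unfolding ms by auto
  qed
  show "L ! i \<le> (spectral_norm A)\<^sup>2" if i: "i < CARD('d)" for i
  proof -
    obtain j where j: "L ! i = \<mu> j" using mem[OF i] by blast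
    have "norm (v j) = 1" using orth[of j j] by (simp add: norm_eq_1)
    moreover have "norm (A *v v j) \<le> spectral_norm A * norm (v j)"
      unfolding spectral_norm_def by (intro onorm matrix_vector_mul_bounded_linear)
    ultimately show ?thesis unfolding j mu by (simp add: power_mono)
  qed
  have nonneg: "0 \<le> L ! i" if "i < CARD('d)" for i
    using mem[OF that] mu by auto
  define S where "S = {i. i < CARD('d) \<and> L ! i \<noteq> 0}"
  have "card S = length (filter (\<lambda>x. x \<noteq> 0) L)"
    by (simp add: S_def length_filter_conv_card len)
  also have "\<dots> = size (filter_mset (\<lambda>x. x \<noteq> 0) (mset L))"
    by (metis mset_filter size_mset)
  also have "\<dots> = rank A"
    by (simp add: ms rank filter_mset_image_mset)
  finally have "card S = rank A" .
  moreover have "S = {..<card S}"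
  proof (rule downward_closed_eq_lessThan)
    fix i j assume "i \<le> j" "j \<in> S"
    with anti[of i j] nonneg[of j] show "i \<in> S" by (auto simp: S_def)
  qed (simp add: S_def)
  ultimately have S: "S = {..<rank A}" by simp
  show "0 < L ! i" if "i < rank A" for i
  proof -
    have "i \<in> S" using that S by simp
    with nonneg[of i] show ?thesis by (auto simp: S_def less_le)
  qed
  show "L ! i = 0" if "rank A \<le> i" "i < CARD('d)" for i
  proof -
    have "i \<notin> S" using that S by simp
    with that show ?thesis by (simp add: S_def)
  qed
qed

section \<open>Roots and derivatives of complex polynomials\<close>

text \<open>
  The logarithmic derivative \<open>f'/f\<close> is the sum of \<open>1/(z - w)\<close> over the roots \<open>w\<close> with multiplicity. This
  is used twice: for the location of the roots of \<open>f'\<close>, and at \<open>z = 0\<close> for the sum of the inverse roots.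
\<close>

lemma pderiv_eq_sum_inverse_roots:
  fixes f :: "complex poly"
  assumes "f \<noteq> 0"
  obtains W where "size W = degree f" "\<And>z. poly f z = 0 \<longleftrightarrow> z \<in># W"
    "\<And>z. poly f z \<noteq> 0 \<Longrightarrow> poly (pderiv f) z = poly f z * (\<Sum>w\<in>#W. 1 / (z - w))"
proof -
  from alg_closed_imp_factorization[OF assms] obtain W where W: "size W = degree f"
    and f: "f = smult (lead_coeff f) (\<Prod>w\<in>#W. [:- w, 1:])" by auto
  let ?P = "\<lambda>W. \<Prod>w\<in>#W. [:- w, 1:] :: complex poly"
  have zero: "poly (?P U) z = 0 \<longleftrightarrow> z \<in># U" for U z
    by (induction U) auto
  have "poly f z = 0 \<longleftrightarrow> z \<in># W" for z
    using assms zero[of W z] by (subst f) auto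
  moreover have deriv: "poly (pderiv (?P U)) z = poly (?P U) z * (\<Sum>w\<in>#U. 1 / (z - w))"
    if "poly (?P U) z \<noteq> 0" for U z
    using that
  proof (induction U)
    case (add x U)
    hence "z \<noteq> x" "poly (pderiv (?P U)) z = poly (?P U) z * (\<Sum>w\<in>#U. 1 / (z - w))" by auto
    thus ?case by (simp add: pderiv_mult pderiv_pCons field_simps del: mult_pCons_left)
  qed simp
  have "poly (pderiv f) z = poly f z * (\<Sum>w\<in>#W. 1 / (z - w))" if "poly f z \<noteq> 0" for z
  proof -
    have "poly (?P W) z \<noteq> 0" using that by (subst (asm) f) auto
    from deriv[OF this] show ?thesis by (subst (1 2) f) (simp add: pderiv_smult)
  qed
  ultimately show ?thesis using W that by blast
qed

lemma sum_mset_nonneg_real: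
  fixes h :: "'a \<Rightarrow> real"
  shows "(\<And>w. w \<in># W \<Longrightarrow> 0 \<le> h w) \<Longrightarrow> 0 \<le> (\<Sum>w\<in>#W. h w)"
  by (induction W) auto

lemma Re_sum_mset: "Re (\<Sum>w\<in>#W. h w) = (\<Sum>w\<in>#W. Re (h w))"
  by (induction W) auto

text \<open>
  The Gauss-Lucas theorem for a half plane. If every \<open>u (z - w)\<close> has positive real part, so has its
  inverse, hence \<open>f'(z)/(u f(z))\<close> is a nonempty sum of numbers with positive real part.
\<close>

lemma pderiv_nonzero_outside_half_plane:
  fixes f :: "complex poly"
  assumes "degree f > 0" "\<And>w. poly f w = 0 \<Longrightarrow> Re (u * w) < Re (u * z)"
  shows "poly (pderiv f) z \<noteq> 0"
proof -
  have f0: "f \<noteq> 0" using assms(1) by auto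
  have fz: "poly f z \<noteq> 0" using assms(2)[of z] by auto
  obtain W where W: "size W = degree f" "\<And>z. poly f z = 0 \<longleftrightarrow> z \<in># W"
    "\<And>z. poly f z \<noteq> 0 \<Longrightarrow> poly (pderiv f) z = poly f z * (\<Sum>w\<in>#W. 1 / (z - w))"
    using pderiv_eq_sum_inverse_roots[OF f0] by metis
  have pos: "Re (inverse u * (1 / (z - w))) > 0" if "w \<in># W" for w
  proof -
    have "Re (u * (z - w)) > 0" using assms(2)[of w] W(2)[of w] that by (simp add: algebra_simps)
    hence "Re (inverse (u * (z - w))) > 0"
      unfolding inverse_complex.sel by (intro divide_pos_pos add_pos_nonneg) auto
    thus ?thesis by (simp add: divide_inverse)
  qed
  have "W \<noteq> {#}" using W(1) assms(1) by auto
  then obtain w U where U: "W = add_mset w U" by (meson multiset_cases)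
  have "(\<Sum>w\<in>#U. Re (inverse u * (1 / (z - w)))) \<ge> 0"
    using pos U by (intro sum_mset_nonneg_real) (auto intro: less_imp_le)
  with pos[of w] have "(\<Sum>w\<in>#W. Re (inverse u * (1 / (z - w)))) > 0"
    by (simp add: U)
  hence "Re (inverse u * (\<Sum>w\<in>#W. 1 / (z - w))) > 0"
    by (simp add: sum_mset_distrib_left Re_sum_mset)
  hence "(\<Sum>w\<in>#W. 1 / (z - w)) \<noteq> 0" by auto
  with W(3)[OF fz] fz show ?thesis by simp
qed

section \<open>Polynomials with positive real roots\<close>

text \<open>
  The condition speaks of the complex roots because the Gauss-Lucas argument applies to these
  directly, with no factorisation over the reals to carry along.
\<close>

definition positive_rooted :: "real poly \<Rightarrow> bool" where
  "positive_rooted f \<longleftrightarrow>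
     f \<noteq> 0 \<and> (\<forall>z. poly (map_poly complex_of_real f) z = 0 \<longrightarrow> z \<in> \<real> \<and> Re z > 0)"

lemma map_poly_of_real_pderiv:
  "map_poly complex_of_real (pderiv f) = pderiv (map_poly complex_of_real f)"
  by (intro poly_eqI) (simp add: coeff_map_poly coeff_pderiv)

lemma poly_map_poly_of_real:
  "poly (map_poly complex_of_real f) (of_real x) = of_real (poly f x)"
  by (induction f) (auto simp: map_poly_pCons)

text \<open>
  The half planes with \<open>u = \<i>\<close> and \<open>u = - \<i>\<close> confine the roots of the derivative to the real line;
  the one with \<open>u = - 1\<close> keeps them to the right of the smallest root of \<open>f\<close>.
\<close>

lemma pderiv_root_real_ge_some_root:
  assumes "degree f > 0" "poly (map_poly complex_of_real (pderiv f)) z = 0"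
    and real: "\<And>w. poly (map_poly complex_of_real f) w = 0 \<Longrightarrow> w \<in> \<real>"
  shows "z \<in> \<real> \<and> (\<exists>w. poly (map_poly complex_of_real f) w = 0 \<and> Re w \<le> Re z)"
proof -
  let ?F = "map_poly complex_of_real f"
  have deg: "degree ?F > 0" using assms(1) by (simp add: degree_map_poly)
  have F': "poly (pderiv ?F) z = 0" using assms(2) by (simp add: map_poly_of_real_pderiv)
  have *: "\<exists>w. poly ?F w = 0 \<and> Re (u * z) \<le> Re (u * w)" for u
    using pderiv_nonzero_outside_half_plane[OF deg, of u z] F' by (meson not_le)
  have im: "Im w = 0" if "poly ?F w = 0" for w
    using real[OF that] by (simp add: complex_is_Real_iff)
  from *[of \<i>] *[of "-\<i>"] have "Im z = 0" using im by force
  moreover from *[of "-1"] have "\<exists>w. poly ?F w = 0 \<and> Re w \<le> Re z" by auto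
  ultimately show ?thesis by (simp add: complex_is_Real_iff)
qed

lemma positive_rooted_prod_one_minus:
  assumes "finite I" "\<And>i. i \<in> I \<Longrightarrow> 0 < a i"
  shows "positive_rooted (\<Prod>i\<in>I. [:1, - a i:])"
proof -
  have mult: "map_poly complex_of_real ([:1, - c:] * p)
      = [:1, - complex_of_real c:] * map_poly complex_of_real p" for c p
    by (intro poly_eqI) (simp add: coeff_map_poly coeff_pCons split: nat.split)
  have eq: "map_poly complex_of_real (\<Prod>i\<in>I. [:1, - a i:]) = (\<Prod>i\<in>I. [:1, - complex_of_real (a i):])"
    using assms(1)
  proof (induction I)
    case (insert i I)
    show ?case
      by (simp only: prod.insert[OF insert.hyps] mult insert.IH)
  qed simp
  have "z \<in> \<real> \<and> Re z > 0" if z: "poly (map_poly complex_of_real (\<Prod>i\<in>I. [:1, - a i:])) z = 0" for z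
  proof -
    obtain i where i: "i \<in> I" "1 - z * complex_of_real (a i) = 0"
      using z assms(1) by (auto simp: eq poly_prod)
    hence "z = of_real (1 / a i)" using assms(2)[OF i(1)] by (simp add: field_simps)
    thus ?thesis using assms(2)[OF i(1)] by simp
  qed
  moreover have "(\<Prod>i\<in>I. [:1, - a i:]) \<noteq> 0" using assms(1) by simp
  ultimately show ?thesis by (simp add: positive_rooted_def)
qed

lemma coeff_dxd: "coeff (dxd f) n = (real (Suc n))\<^sup>2 * coeff f (Suc n)"
  by (simp add: dxd_def coeff_pderiv power2_eq_square)

text \<open>
  Since \<open>\<partial> x \<partial>\<close> sends \<open>x ^ m\<close> to \<open>m\<^sup>2 x ^ (m - 1)\<close>, its \<open>k\<close>-th power acts on each coefficient separately. Only
  \<open>n = 0\<close> and \<open>n = 1\<close> matter for the bound on the roots.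
\<close>

lemma coeff_funpow_dxd:
  "coeff ((dxd ^^ k) f) n = (fact (n + k) / fact n)\<^sup>2 * coeff f (n + k)"
proof (induction k arbitrary: n)
  case (Suc k)
  have "coeff ((dxd ^^ Suc k) f) n
      = (real (Suc n))\<^sup>2 * ((fact (Suc n + k) / fact (Suc n))\<^sup>2 * coeff f (Suc n + k))"
    by (simp only: funpow.simps o_apply coeff_dxd Suc.IH)
  also have "\<dots> = (real (Suc n) * (fact (Suc n + k) / fact (Suc n)))\<^sup>2 * coeff f (Suc n + k)"
    by (simp only: power_mult_distrib mult.assoc)
  also have "real (Suc n) * (fact (Suc n + k) / fact (Suc n)) = fact (n + Suc k) / fact n"
    by (simp add: divide_simps)
  finally show ?case by simp
qed simp

lemma degree_dxd: "degree (dxd f) = degree f - 1"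
proof (cases "degree f = 0")
  case True
  thus ?thesis using degree_eq_zeroE[of f] by (force simp: dxd_def pderiv_pCons)
next
  case False
  have "coeff (dxd f) (degree f - 1) \<noteq> 0" using False by (auto simp: coeff_dxd)
  moreover have "coeff (dxd f) n = 0" if "n > degree f - 1" for n
    using that False by (simp add: coeff_dxd coeff_eq_0)
  ultimately show ?thesis by (metis coeff_eq_0 le_degree linorder_neqE_nat order.asym degree_le le_antisym)
qed

text \<open>
  Multiplying the derivative by \<open>x\<close> adds the root 0, so the second differentiation only yields
  nonnegative roots. The value of the result at 0 is that of the first derivative, which is nonzero;
  this excludes the root 0.
\<close>

lemma positive_rooted_dxd:
  assumes f: "positive_rooted f" and deg: "degree f > 0"
  shows "positive_rooted (dxd f)"
proof -
  let ?C = "map_poly complex_of_real"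
  define g where "g = [:0, 1:] * pderiv f"
  have f'0: "pderiv f \<noteq> 0" using deg by (simp add: pderiv_eq_0_iff)
  have f': "z \<in> \<real> \<and> Re z > 0" if "poly (?C (pderiv f)) z = 0" for z
    using pderiv_root_real_ge_some_root[OF deg that] f by (force simp: positive_rooted_def)
  have Cg: "poly (?C g) z = z * poly (?C (pderiv f)) z" for z
    by (simp add: g_def map_poly_pCons)
  have g: "z \<in> \<real> \<and> Re z \<ge> 0" if "poly (?C g) z = 0" for z
    using that f'[of z] by (auto simp: Cg)
  have degg: "degree g > 0" using f'0 by (simp add: g_def degree_mult_eq)
  have "z \<in> \<real> \<and> Re z > 0" if z: "poly (?C (dxd f)) z = 0" for z
  proof -
    have "z \<in> \<real> \<and> Re z \<ge> 0"
      using pderiv_root_real_ge_some_root[OF degg, of z] z g by (force simp: dxd_def g_def)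
    moreover have "z \<noteq> 0"
    proof
      assume "z = 0"
      with z have "poly (dxd f) 0 = 0" using poly_map_poly_of_real[of "dxd f" 0] by simp
      hence "poly (pderiv f) 0 = 0" by (simp add: dxd_def pderiv_pCons)
      with f'[of 0] poly_map_poly_of_real[of "pderiv f" 0] show False by simp
    qed
    ultimately show ?thesis by (auto simp: complex_is_Real_iff complex_eq_iff less_le)
  qed
  moreover have "dxd f \<noteq> 0" using degg by (simp add: dxd_def g_def pderiv_eq_0_iff)
  ultimately show ?thesis by (simp add: positive_rooted_def)
qed

lemma positive_rooted_funpow_dxd:
  assumes "positive_rooted f" "k \<le> degree f"
  shows "positive_rooted ((dxd ^^ k) f) \<and> degree ((dxd ^^ k) f) = degree f - k"
  using assms(2)
proof (induction k)
  case (Suc k)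
  thus ?case using positive_rooted_dxd[of "(dxd ^^ k) f"] by (simp add: degree_dxd)
qed (use assms in auto)

text \<open>
  The logarithmic derivative at 0. Passing to real parts turns the complex roots into the multiset
  of real ones.
\<close>

lemma coeff_ratio_eq_sum_inverse_roots:
  assumes f: "positive_rooted f"
  obtains W where "\<And>s. poly f s = 0 \<Longrightarrow> s \<in># W" "\<And>s. s \<in># W \<Longrightarrow> s > 0"
    "- coeff f 1 / coeff f 0 = (\<Sum>s\<in>#W. 1 / s)"
proof -
  let ?F = "map_poly complex_of_real f"
  have F0: "?F \<noteq> 0" using f by (simp add: positive_rooted_def map_poly_eq_0_iff)
  have pos: "w \<in> \<real> \<and> Re w > 0" if "poly ?F w = 0" for w
    using f that by (simp add: positive_rooted_def)
  obtain W where W: "\<And>z. poly ?F z = 0 \<longleftrightarrow> z \<in># W"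
    "\<And>z. poly ?F z \<noteq> 0 \<Longrightarrow> poly (pderiv ?F) z = poly ?F z * (\<Sum>w\<in>#W. 1 / (z - w))"
    using pderiv_eq_sum_inverse_roots[OF F0] by metis
  have nz: "poly ?F 0 \<noteq> 0" using pos[of 0] by auto
  have c0: "poly ?F 0 = of_real (coeff f 0)"
    by (simp add: poly_0_coeff_0 coeff_map_poly)
  have c1: "poly (pderiv ?F) 0 = of_real (coeff f 1)"
    by (simp add: poly_0_coeff_0 coeff_map_poly coeff_pderiv)
  have "complex_of_real (coeff f 1 / coeff f 0) = (\<Sum>w\<in>#W. 1 / (0 - w))"
    using W(2)[OF nz] nz unfolding c0 c1 by (simp add: field_simps)
  hence "coeff f 1 / coeff f 0 = Re (\<Sum>w\<in>#W. 1 / (0 - w))"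
    by (metis Re_complex_of_real)
  also have "\<dots> = - (\<Sum>w\<in>#W. Re (1 / w))"
    unfolding Re_sum_mset by (induction W) auto
  also have "(\<Sum>w\<in>#W. Re (1 / w)) = (\<Sum>w\<in>#W. 1 / Re w)"
  proof (intro arg_cong[of _ _ sum_mset] image_mset_cong)
    fix w assume "w \<in># W"
    with pos[of w] W(1) have "w = of_real (Re w)" by (auto simp: complex_is_Real_iff complex_eq_iff)
    thus "Re (1 / w) = 1 / Re w" by (metis Re_complex_of_real of_real_1 of_real_divide)
  qed
  finally have "- coeff f 1 / coeff f 0 = (\<Sum>s\<in>#image_mset Re W. 1 / s)"
    by (simp add: multiset.map_comp o_def)
  moreover have "s \<in># image_mset Re W" if "poly f s = 0" for s
  proof -
    have "complex_of_real s \<in># W" using that by (simp add: poly_map_poly_of_real flip: W(1))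
    thus ?thesis by force
  qed
  moreover have "s > 0" if "s \<in># image_mset Re W" for s
    using that pos W(1) by auto
  ultimately show ?thesis using that by blast
qed

lemma coeff_ratio_nonneg:
  assumes "positive_rooted f"
  shows "0 \<le> - coeff f 1 / coeff f 0"
proof -
  from coeff_ratio_eq_sum_inverse_roots[OF assms] obtain W where W: "\<And>s. s \<in># W \<Longrightarrow> s > 0"
    "- coeff f 1 / coeff f 0 = (\<Sum>s\<in>#W. 1 / s)" by metis
  show ?thesis unfolding W(2) by (intro sum_mset_nonneg_real) (simp add: W(1) less_imp_le)
qed

text \<open>
  All summands in the sum of the inverse roots are positive, so each is at most the sum. This crude
  estimate of the smallest root already suffices for the theorem.
\<close>

lemma inverse_root_le_coeff_ratio:
  assumes "positive_rooted f" and "poly f s = 0"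
  shows "1 / s \<le> - coeff f 1 / coeff f 0"
proof -
  from coeff_ratio_eq_sum_inverse_roots[OF assms(1)] obtain W where W: "s \<in># W"
    "\<And>s. s \<in># W \<Longrightarrow> s > 0" "- coeff f 1 / coeff f 0 = (\<Sum>s\<in>#W. 1 / s)"
    using assms(2) by metis
  from W(1) obtain U where U: "W = add_mset s U" by (meson multi_member_split)
  have "0 \<le> (\<Sum>s\<in>#U. 1 / s)"
    using W(2) U by (intro sum_mset_nonneg_real) (simp add: less_imp_le)
  thus ?thesis unfolding W(3) U by simp
qed

section \<open>Reversed polynomials\<close>

lemma poly_map_poly_reverse_poly:
  assumes "degree p \<le> d" "z \<noteq> 0"
  shows "poly (map_poly complex_of_real (reverse_poly d p)) z
    = z ^ d * poly (map_poly complex_of_real p) (1 / z)"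
proof -
  have "poly (map_poly complex_of_real p) (1 / z) = (\<Sum>i\<le>d. of_real (coeff p i) * (1 / z) ^ i)"
    unfolding poly_altdef using assms(1)
    by (intro sum.mono_neutral_cong_left) (auto simp: coeff_eq_0 coeff_map_poly degree_map_poly)
  moreover have "z ^ (d - i) = z ^ d * (1 / z) ^ i" if "i \<le> d" for i
    using that assms(2) by (simp add: power_diff power_one_over divide_simps)
  moreover have "map_poly complex_of_real (reverse_poly d p)
      = (\<Sum>i\<le>d. monom (of_real (coeff p i)) (d - i))"
    unfolding reverse_poly_def
    by (intro poly_eqI) (simp add: coeff_map_poly coeff_sum if_distrib[of complex_of_real] cong: if_cong)
  ultimately show ?thesis
    by (simp add: poly_sum poly_monom sum_distrib_left mult_ac)
qed

lemma coeff_reverse_poly: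
  assumes "n \<le> d"
  shows "coeff (reverse_poly d p) n = coeff p (d - n)"
proof -
  have "coeff (reverse_poly d p) n = (\<Sum>i\<le>d. if d - n = i then coeff p i else 0)"
    unfolding reverse_poly_def coeff_sum using assms by (intro sum.cong) auto
  thus ?thesis by simp
qed

text \<open>
  The nonzero roots of the reversal are the inverses of the roots of \<open>f\<close>. As \<open>degree f < d\<close>, the
  number 0 is a root as well, so the set of roots is nonempty and its maximum is meaningful.
\<close>

lemma reverse_poly_root_bounds:
  assumes f: "positive_rooted f" and deg: "degree f < d"
  shows "real_rooted (reverse_poly d f)"
    and "maxroot (reverse_poly d f) \<le> - coeff f 1 / coeff f 0"
proof -
  let ?g = "reverse_poly d f" and ?b = "- coeff f 1 / coeff f 0"
  have f0: "poly f 0 \<noteq> 0"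
    using f poly_map_poly_of_real[of f 0] by (auto simp: positive_rooted_def)
  hence g0: "?g \<noteq> 0"
    using coeff_reverse_poly[of d d f] by (auto simp: poly_0_coeff_0)
  have "z \<in> \<real>" if z: "poly (map_poly complex_of_real ?g) z = 0" for z
  proof (cases "z = 0")
    case False
    with z deg have "poly (map_poly complex_of_real f) (1 / z) = 0"
      by (simp add: poly_map_poly_reverse_poly)
    with f have "1 / z \<in> \<real>" by (simp add: positive_rooted_def)
    from Reals_divide[OF Reals_1 this] show ?thesis by simp
  qed simp
  with g0 show "real_rooted ?g" by (simp add: real_rooted_def)
  have root0: "poly ?g 0 = 0"
    using deg coeff_reverse_poly[of 0 d f] by (simp add: poly_0_coeff_0 coeff_eq_0)
  have le: "x \<le> ?b" if x: "poly ?g x = 0" "x \<noteq> 0" for x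
    using inverse_root_le_coeff_ratio[OF f, of "1 / x"] x deg by (simp add: poly_reverse_poly)
  have "x \<le> ?b" if "poly ?g x = 0" for x
    using le[OF that] coeff_ratio_nonneg[OF f] by (cases "x = 0") auto
  thus "maxroot ?g \<le> ?b"
    unfolding maxroot_def using g0 root0 by (subst Max_le_iff) (auto simp: poly_roots_finite)
qed

text \<open>
  The two sides are compared at all \<open>x \<noteq> 0\<close>; the factor \<open>[:0, 1:]\<close> extends the agreement to \<open>x = 0\<close>.
\<close>

lemma reverse_poly_prod_linear:
  fixes a :: "'b \<Rightarrow> real"
  assumes "finite I"
  shows "reverse_poly (card I) (\<Prod>i\<in>I. [:- a i, 1:]) = (\<Prod>i\<in>I. [:1, - a i:])"
proof -
  have deg: "degree (\<Prod>i\<in>I. [:- a i, 1:]) \<le> card I"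
    using assms by (subst degree_prod_eq_sum_degree) auto
  have "poly ([:0, 1:] * reverse_poly (card I) (\<Prod>i\<in>I. [:- a i, 1:])) x
      = poly ([:0, 1:] * (\<Prod>i\<in>I. [:1, - a i:])) x" for x
  proof (cases "x = 0")
    case False
    have "x ^ card I * (\<Prod>i\<in>I. 1 / x - a i) = (\<Prod>i\<in>I. x * (1 / x - a i))"
      by (simp add: prod.distrib)
    also have "\<dots> = (\<Prod>i\<in>I. 1 - x * a i)"
      using False by (intro prod.cong) (auto simp: algebra_simps)
    finally show ?thesis
      using False deg by (simp add: poly_reverse_poly poly_prod)
  qed simp
  hence "[:0, 1:] * reverse_poly (card I) (\<Prod>i\<in>I. [:- a i, 1:]) = [:0, 1:] * (\<Prod>i\<in>I. [:1, - a i:])"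
    by (intro poly_eq_poly_eq_iff[THEN iffD1] ext)
  thus ?thesis by simp
qed

section \<open>Elementary symmetric functions\<close>

definition elem_sym :: "nat \<Rightarrow> ('a \<Rightarrow> 'b::comm_ring_1) \<Rightarrow> 'a set \<Rightarrow> 'b" where
  "elem_sym k a I = (\<Sum>X | X \<subseteq> I \<and> card X = k. \<Prod>i\<in>X. a i)"

lemma coeff_prod_one_minus:
  fixes a :: "'a \<Rightarrow> 'b::comm_ring_1"
  assumes "finite I"
  shows "coeff (\<Prod>i\<in>I. [:1, - a i:]) k = (-1) ^ k * elem_sym k a I"
proof -
  have mon: "(\<Prod>i\<in>X. monom (- a i) 1) = monom ((-1) ^ card X * prod a X) (card X)"
    if "finite X" for X
    using that by (induction X) (auto simp: mult_monom one_pCons monom_0)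
  have "(\<Prod>i\<in>I. [:1, - a i:]) = (\<Prod>i\<in>I. monom (- a i) 1 + 1)"
    by (simp add: monom_altdef one_pCons)
  also have "\<dots> = (\<Sum>X\<in>Pow I. monom ((-1) ^ card X * prod a X) (card X))"
    unfolding prod_add[OF assms] using assms
    by (intro sum.cong) (auto simp: mon[unfolded One_nat_def] finite_subset[OF _ assms])
  also have "coeff \<dots> k = (\<Sum>X\<in>Pow I. if card X = k then (-1) ^ k * prod a X else 0)"
    unfolding coeff_sum by (intro sum.cong) auto
  also have "\<dots> = (\<Sum>X | X \<subseteq> I \<and> card X = k. (-1) ^ k * prod a X)"
    using assms by (intro sum.mono_neutral_cong_right) auto
  finally show ?thesis by (simp add: elem_sym_def sum_distrib_left)
qed

text \<open>
  Replacing \<open>T\<close> by the initial segment of the same size does not increase any entry: the \<open>j\<close>-th element of \<open>T\<close>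
  in increasing order, counted from 0, is at least \<open>j\<close>. The induction removes the largest element.
\<close>

lemma sum_initial_segment_le:
  fixes g :: "nat \<Rightarrow> 'b::ordered_comm_monoid_add"
  assumes "finite T" and "\<And>i j. i \<le> j \<Longrightarrow> j \<in> T \<Longrightarrow> g i \<le> g j"
  shows "(\<Sum>i<card T. g i) \<le> sum g T"
  using assms
proof (induction "card T" arbitrary: T)
  case (Suc m)
  define b where "b = Max T"
  have b: "b \<in> T" unfolding b_def using Suc by (intro Max_in) auto
  have m: "card (T - {b}) = m" using b Suc by simp
  have "T - {b} \<subseteq> {..<b}"
    using Suc.prems(1) by (auto simp: b_def less_le)
  from card_mono[OF _ this] m have "m \<le> b" by simp
  have "(\<Sum>i<card T. g i) = g m + (\<Sum>i<card (T - {b}). g i)"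
    using Suc.hyps(2)[symmetric] m by (simp add: add.commute)
  also have "\<dots> \<le> g b + sum g (T - {b})"
    using Suc m b \<open>m \<le> b\<close> by (intro add_mono Suc.hyps(1) Suc.prems) auto
  also have "\<dots> = sum g T"
    using b Suc.prems(1) by (simp add: sum.remove)
  finally show ?case .
qed simp

text \<open>
  Both sides count the pairs of a set \<open>S\<close> of size \<open>k\<close> and an element \<open>i\<close> outside it, where
  \<open>T = insert i S\<close>.
\<close>

lemma sum_deleted_products:
  fixes a :: "'a \<Rightarrow> 'b::comm_ring_1"
  assumes "finite I"
  shows "(\<Sum>T | T \<subseteq> I \<and> card T = Suc k. \<Sum>i\<in>T. prod a (T - {i}))
    = of_nat (card I - k) * elem_sym k a I"
proof -
  let ?P = "\<lambda>m. {X. X \<subseteq> I \<and> card X = m}"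
  have fin: "finite (?P m)" for m using assms by simp
  have finX: "finite X" if "X \<subseteq> I" for X using that assms by (rule finite_subset)
  have "(\<Sum>T\<in>?P (Suc k). \<Sum>i\<in>T. prod a (T - {i}))
      = (\<Sum>(T, i)\<in>(SIGMA T:?P (Suc k). T). prod a (T - {i}))"
    using fin finX by (intro sum.Sigma) auto
  also have "\<dots> = (\<Sum>(S, i)\<in>(SIGMA S:?P k. I - S). prod a S)"
    by (intro sum.reindex_bij_witness[of _ "\<lambda>(S, i). (insert i S, i)" "\<lambda>(T, i). (T - {i}, i)"])
      (auto simp: finX)
  also have "\<dots> = (\<Sum>S\<in>?P k. \<Sum>i\<in>I - S. prod a S)"
    using fin assms by (intro sum.Sigma[symmetric]) auto
  also have "\<dots> = (\<Sum>S\<in>?P k. of_nat (card I - k) * prod a S)"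
    by (intro sum.cong) (auto simp: finX card_Diff_subset)
  finally show ?thesis by (simp add: elem_sym_def sum_distrib_left)
qed

text \<open>
  For each \<open>T\<close> of size \<open>k + 1\<close>, the sum of the products over the sets \<open>T - {i}\<close> is \<open>prod a T\<close> times the
  sum of \<open>1 / a i\<close> over \<open>T\<close>. As \<open>1 / a i\<close> increases with \<open>i\<close>, that sum is smallest for the initial
  segment. Summation over \<open>T\<close> and double counting give the inequality. For constant \<open>a\<close> it is an
  equality.
\<close>

lemma elem_sym_Suc_bound:
  fixes a :: "nat \<Rightarrow> real"
  assumes pos: "\<And>i. i < t \<Longrightarrow> 0 < a i" and anti: "\<And>i j. i \<le> j \<Longrightarrow> j < t \<Longrightarrow> a j \<le> a i"
  shows "elem_sym (Suc k) a {..<t} * (\<Sum>i\<le>k. 1 / a i) \<le> real (t - k) * elem_sym k a {..<t}"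
proof -
  have "prod a T * (\<Sum>i\<le>k. 1 / a i) \<le> (\<Sum>i\<in>T. prod a (T - {i}))"
    if T: "T \<subseteq> {..<t}" "card T = Suc k" for T
  proof -
    have fin: "finite T" using T finite_subset by auto
    have "(\<Sum>i\<le>k. 1 / a i) \<le> (\<Sum>i\<in>T. 1 / a i)"
      using sum_initial_segment_le[OF fin, of "\<lambda>i. 1 / a i"] T pos anti
      by (force simp: lessThan_Suc_atMost intro: divide_left_mono)
    hence "prod a T * (\<Sum>i\<le>k. 1 / a i) \<le> prod a T * (\<Sum>i\<in>T. 1 / a i)"
      using T pos by (intro mult_left_mono prod_nonneg) (auto intro: less_imp_le)
    also have "\<dots> = (\<Sum>i\<in>T. prod a (T - {i}))"
      unfolding sum_distrib_left
    proof (intro sum.cong refl)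
      fix i assume i: "i \<in> T"
      hence "a i > 0" using T pos by auto
      with i fin show "prod a T * (1 / a i) = prod a (T - {i})"
        by (simp add: prod.remove)
    qed
    finally show ?thesis .
  qed
  hence "elem_sym (Suc k) a {..<t} * (\<Sum>i\<le>k. 1 / a i)
      \<le> (\<Sum>T | T \<subseteq> {..<t} \<and> card T = Suc k. \<Sum>i\<in>T. prod a (T - {i}))"
    unfolding elem_sym_def sum_distrib_right by (intro sum_mono) auto
  thus ?thesis by (simp add: sum_deleted_products)
qed

lemma elem_sym_pos:
  fixes a :: "nat \<Rightarrow> real"
  assumes "\<And>i. i < t \<Longrightarrow> 0 < a i" "k \<le> t"
  shows "0 < elem_sym k a {..<t}"
  unfolding elem_sym_def
proof (rule sum_pos)
  show "{X. X \<subseteq> {..<t} \<and> card X = k} \<noteq> {}"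
    using assms(2) by (auto intro!: exI[of _ "{..<k}"])
  show "0 < prod a X" if "X \<in> {X. X \<subseteq> {..<t} \<and> card X = k}" for X
    using that assms(1) by (intro prod_pos) auto
qed simp

section \<open>The bound for the largest root\<close>

text \<open>
  The reversal of \<open>\<Prod>(x - a i)\<close> is \<open>q = \<Prod>(1 - a i x)\<close>, whose coefficients are the signed elementary symmetric
  functions \<open>e j\<close> of \<open>a\<close>. Applying \<open>(\<partial> x \<partial>)^k\<close> moves \<open>e k\<close> and \<open>e (k + 1)\<close> to the degrees 0 and 1, with ratio of the
  scaling factors \<open>(k + 1)\<^sup>2\<close>, so the sum of the inverse roots becomes \<open>(k + 1)\<^sup>2 e (k + 1) / e k\<close>.
\<close>

lemma reversed_dxd_roots:
  fixes a :: "nat \<Rightarrow> real"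
  assumes pos: "\<And>i. i < t \<Longrightarrow> 0 < a i" and anti: "\<And>i j. i \<le> j \<Longrightarrow> j < t \<Longrightarrow> a j \<le> a i"
    and zero: "\<And>i. t \<le> i \<Longrightarrow> i < d \<Longrightarrow> a i = 0"
    and k: "0 < k" "k < t" and td: "t \<le> d"
  defines "g \<equiv> reverse_poly d ((dxd ^^ k) (reverse_poly d (\<Prod>i<d. [:- a i, 1:])))"
  shows "real_rooted g"
    and "maxroot g \<le> (real (k + 1))\<^sup>2 * real (t - k) / (\<Sum>i\<le>k. 1 / a i)"
proof -
  define q where "q = (\<Prod>i<t. [:1, - a i:])"
  define Q where "Q = (dxd ^^ k) q"
  have "reverse_poly d (\<Prod>i<d. [:- a i, 1:]) = (\<Prod>i<d. [:1, - a i:])"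
    using reverse_poly_prod_linear[of "{..<d}" a] by simp
  also have "\<dots> = q"
    unfolding q_def using td zero by (intro prod.mono_neutral_right) (auto simp: one_pCons)
  finally have g: "g = reverse_poly d Q" by (simp add: g_def Q_def)
  have degq: "degree q = t"
    unfolding q_def using pos by (subst degree_prod_eq_sum_degree) (auto simp: less_imp_neq[symmetric])
  have q: "positive_rooted q"
    unfolding q_def using pos by (intro positive_rooted_prod_one_minus) auto
  have Q: "positive_rooted Q" "degree Q < d"
    using positive_rooted_funpow_dxd[OF q, of k] k td by (auto simp: Q_def degq)
  show "real_rooted g" unfolding g by (rule reverse_poly_root_bounds(1)[OF Q])
  let ?e = "\<lambda>j. elem_sym j a {..<t}"
  have e: "?e k > 0" using elem_sym_pos[of t a k] pos k by simp
  have S: "(\<Sum>i\<le>k. 1 / a i) > 0"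
    using pos k by (intro sum_pos) auto
  have c0: "coeff Q 0 = (fact k)\<^sup>2 * ((-1) ^ k * ?e k)"
    by (simp add: Q_def coeff_funpow_dxd q_def coeff_prod_one_minus)
  have c1: "coeff Q 1 = - ((real (k + 1))\<^sup>2 * (fact k)\<^sup>2 * ((-1) ^ k * ?e (Suc k)))"
    by (simp add: Q_def coeff_funpow_dxd q_def coeff_prod_one_minus power_mult_distrib)
  have "maxroot g \<le> - coeff Q 1 / coeff Q 0"
    unfolding g by (rule reverse_poly_root_bounds(2)[OF Q])
  also have "\<dots> = (real (k + 1))\<^sup>2 * (?e (Suc k) / ?e k)"
    unfolding c0 c1 using e by (simp add: divide_simps)
  also have "?e (Suc k) / ?e k \<le> real (t - k) / (\<Sum>i\<le>k. 1 / a i)"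
    using elem_sym_Suc_bound[of t a k] pos anti e S by (simp add: divide_simps mult_ac)
  finally show "maxroot g \<le> (real (k + 1))\<^sup>2 * real (t - k) / (\<Sum>i\<le>k. 1 / a i)"
    by (simp add: mult_left_mono)
qed

text \<open>
  Let \<open>\<rho> = 1 / lam (k + 1)\<close> and let \<open>m\<close> be the mean of the first \<open>k\<close> inverses \<open>1 / lam i\<close>. By definition
  \<open>alpha = (\<rho> - m) / (\<rho> - 1)\<close>, that is, \<open>m = (1 - alpha) \<rho> + alpha\<close> is a weighted mean of \<open>\<rho>\<close> and 1. The gap between
  \<open>lam k\<close> and \<open>lam 1\<close> gives \<open>1 < m < \<rho>\<close>, hence the range of \<open>alpha\<close>.
  Moreover \<open>m\<close> and \<open>\<rho>\<close> are both at least \<open>(1 - alpha) \<rho>\<close>, which gives the second part.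
\<close>

lemma alpha_bounds:
  fixes lam :: "nat \<Rightarrow> real"
  assumes k: "2 \<le> k"
    and pos: "\<And>i. 1 \<le> i \<Longrightarrow> i \<le> k + 1 \<Longrightarrow> 0 < lam i"
    and le1: "\<And>i. 1 \<le> i \<Longrightarrow> i \<le> k + 1 \<Longrightarrow> lam i \<le> 1"
    and anti: "\<And>i j. 1 \<le> i \<Longrightarrow> i \<le> j \<Longrightarrow> j \<le> k + 1 \<Longrightarrow> lam j \<le> lam i"
    and gap: "lam k < lam 1"
  shows "alpha lam k \<in> {0<..<1}"
    and "real (k + 1) * (1 - alpha lam k) / lam (k + 1) \<le> (\<Sum>i=1..k+1. 1 / lam i)"
proof -
  define S where "S = (\<Sum>i=1..k. 1 / lam i)"
  define \<rho> where "\<rho> = 1 / lam (k + 1)"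
  have alpha: "alpha lam k = (\<rho> - S / real k) / (\<rho> - 1)"
    by (simp add: alpha_def S_def \<rho>_def)
  have inv: "1 \<le> 1 / lam i" "1 / lam i \<le> \<rho>" if "i \<in> {1..k}" for i
    using that pos[of i] pos[of "k + 1"] le1[of i] anti[of i "k + 1"]
    by (auto simp: \<rho>_def divide_simps)
  have "lam k < 1" using gap le1[of 1] by simp
  hence "1 < 1 / lam k" using pos[of k] k by (simp add: divide_simps)
  have "(\<Sum>i=1..k. 1) < S"
    unfolding S_def using inv k \<open>1 < 1 / lam k\<close>
    by (intro sum_strict_mono_ex1) (auto intro!: bexI[of _ k])
  hence S_gt: "real k < S" by simp
  have "lam (k + 1) < lam 1" using gap anti[of k "k + 1"] k by simp
  hence "1 / lam 1 < \<rho>" using pos[of "k + 1"] pos[of 1] by (simp add: \<rho>_def divide_simps)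
  hence "S < (\<Sum>i=1..k. \<rho>)"
    unfolding S_def using inv k
    by (intro sum_strict_mono_ex1) (auto intro!: bexI[of _ 1])
  hence S_lt: "S < real k * \<rho>" by simp
  have "1 < \<rho>" using \<open>1 < 1 / lam k\<close> inv(2)[of k] k by simp
  have "1 < S / real k" "S / real k < \<rho>"
    using S_gt S_lt k by (simp_all add: divide_simps mult_ac)
  with \<open>1 < \<rho>\<close> show range: "alpha lam k \<in> {0<..<1}"
    by (simp add: alpha)
  have "alpha lam k * (\<rho> - 1) = \<rho> - S / real k"
    using \<open>1 < \<rho>\<close> by (simp add: alpha)
  hence "S / real k = (1 - alpha lam k) * \<rho> + alpha lam k"
    by (simp add: algebra_simps)
  hence "(1 - alpha lam k) * \<rho> \<le> S / real k" using range by simp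
  hence "real k * ((1 - alpha lam k) * \<rho>) \<le> S" using k by (simp add: field_simps)
  moreover have "(1 - alpha lam k) * \<rho> \<le> \<rho>" using range \<open>1 < \<rho>\<close> by simp
  ultimately have "real (k + 1) * ((1 - alpha lam k) * \<rho>) \<le> S + \<rho>" by (simp add: algebra_simps)
  thus "real (k + 1) * (1 - alpha lam k) / lam (k + 1) \<le> (\<Sum>i=1..k+1. 1 / lam i)"
    by (simp add: S_def \<rho>_def)
qed

theorem theorem6p1:
  fixes A :: "real ^ 'd ^ 'n" and t k :: nat
  assumes "rank A = t"
    and "spectral_norm A \<le> 1"
    and "2 \<le> k" and "k + 1 \<le> t"
    and "eigval (transpose A ** A) 1 > eigval (transpose A ** A) k"
  shows "alpha (eigval (transpose A ** A)) k \<in> {0<..<1}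
    \<and> real_rooted (transformed_charpoly k A)
    \<and> maxroot (transformed_charpoly k A)
        \<le> (real (t - k + 1) * real t) / (1 - sqrt (alpha (eigval (transpose A ** A)) k))\<^sup>2
            * eigval (transpose A ** A) (k + 1)"
proof -
  define L where "L = eigvals (transpose A ** A)"
  define lam where "lam = eigval (transpose A ** A)"
  define \<alpha> where "\<alpha> = alpha lam k"
  note L = gram_eigvals[where A = A, folded L_def, unfolded assms(1)]
  have lam: "lam i = L ! (i - 1)" for i by (simp add: lam_def eigval_def L_def)
  have "0 \<le> spectral_norm A"
    unfolding spectral_norm_def by (intro onorm_pos_le matrix_vector_mul_bounded_linear)
  hence "(spectral_norm A)\<^sup>2 \<le> 1" using assms(2) by (simp add: power_le_one)
  hence le1: "L ! i \<le> 1" if "i < CARD('d)" for i using L(5)[OF that] by simp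
  have gap: "lam k < lam 1" using assms(5) by (simp add: lam_def)
  have range: "\<alpha> \<in> {0<..<1}"
    and sum: "real (k + 1) * (1 - \<alpha>) / lam (k + 1) \<le> (\<Sum>i=1..k+1. 1 / lam i)"
    unfolding \<alpha>_def
    using alpha_bounds[of k lam, OF assms(3) _ _ _ gap] L(2,4,6) le1 assms(4) by (simp_all add: lam)
  have pos: "0 < lam (k + 1)" using L(6)[of k] assms(4) by (simp add: lam)
  have roots: "real_rooted (transformed_charpoly k A)"
    "maxroot (transformed_charpoly k A) \<le> (real (k + 1))\<^sup>2 * real (t - k) / (\<Sum>i\<le>k. 1 / L ! i)"
    using reversed_dxd_roots[of t "\<lambda>i. L ! i" "CARD('d)" k] L(2,4,6,7) assms(3,4)
    by (simp_all add: transformed_charpoly_def L(3))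
  have "(\<Sum>i\<le>k. 1 / L ! i) = (\<Sum>i=1..k+1. 1 / lam i)"
    by (rule sum.reindex_bij_witness[of _ "\<lambda>i. i - 1" Suc]) (auto simp: lam)
  with sum have sum': "real (k + 1) * (1 - \<alpha>) / lam (k + 1) \<le> (\<Sum>i\<le>k. 1 / L ! i)" by simp
  have s: "0 < sqrt \<alpha>" "sqrt \<alpha> < 1" "(sqrt \<alpha>)\<^sup>2 = \<alpha>" using range by auto
  have sq: "(1 - sqrt \<alpha>)\<^sup>2 \<le> 1 - \<alpha>"
  proof -
    have "\<alpha> \<le> sqrt \<alpha>"
      using s mult_left_mono[of "sqrt \<alpha>" 1 "sqrt \<alpha>"] by (simp add: power2_eq_square)
    moreover have "(1 - sqrt \<alpha>)\<^sup>2 = 1 - 2 * sqrt \<alpha> + (sqrt \<alpha>)\<^sup>2"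
      by (simp add: power2_diff)
    ultimately show ?thesis using s(3) by linarith
  qed
  have kt: "real (k + 1) * real (t - k) \<le> real t * real (t - k + 1)"
    using assms(4) by (intro mult_mono) auto
  have "(real (k + 1))\<^sup>2 * real (t - k) / (\<Sum>i\<le>k. 1 / L ! i)
      \<le> (real (k + 1))\<^sup>2 * real (t - k) / (real (k + 1) * (1 - \<alpha>) / lam (k + 1))"
    using range pos
    by (intro divide_left_mono sum' mult_pos_pos less_le_trans[OF _ sum'] divide_pos_pos) auto
  also have "\<dots> = real (k + 1) * real (t - k) * lam (k + 1) / (1 - \<alpha>)"
    using range pos by (simp add: divide_simps power2_eq_square)
  also have "\<dots> \<le> real t * real (t - k + 1) * lam (k + 1) / (1 - sqrt \<alpha>)\<^sup>2"
    using range pos s sq kt by (intro frac_le mult_right_mono) auto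
  finally have "maxroot (transformed_charpoly k A)
      \<le> (real (t - k + 1) * real t) / (1 - sqrt \<alpha>)\<^sup>2 * lam (k + 1)"
    using roots(2) by (simp add: mult_ac)
  with range roots(1) show ?thesis by (simp add: \<alpha>_def lam_def)
qed

end
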